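(* Let each of $\mathcal R$ and $\mathcal T$ be a Toeplitz operator system $C(S^1)^{(n)}$ ($n\ge 2$) or a Fej\'er-Riesz operator system $C(S^1)_{(n)}$ ($n\ge2$), where the types and sizes of $\mathcal R$ and $\mathcal T$ may be chosen independently. Then $$\mathcal R_+\otimes_{\rm sep}\mathcal T_+\neq\mathcal R_+\otimes_{{\rm sep}^*}\mathcal T_+ .$$
   Context: $C(S^1)^{(n)}$ is the operator system of all $n\times n$ complex Toeplitz matrices (an operator subsystem of $\mathcal M_n(\mathbb C)$; its base cone consists of the positive semidefinite Toeplitz matrices). $C(S^1)_{(n)}$ is the operator subsystem of $C(S^1)$ consisting of all $f(z)=\sum_{\ell=-n+1}^{n-1}\alpha_\ell z^\ell$, $\alpha_\ell\in\mathbb C$; its base cone consists of those $f$ with $f(z)\ge 0$ for all $z\in S^1$. For finite-dimensional operator systems $\mathcal R,\mathcal T$: $\mathcal R_+\otimes_{\rm sep}\mathcal T_+=\{\sum_{j=1}^k a_j\otimes b_j : k\in\mathbb N,\ a_j\in\mathcal R_+,\ b_j\in\mathcal T_+\}$, and $\mathcal R_+\otimes_{{\rm sep}^*}\mathcal T_+=\{x\in(\mathcal R\otimes_{\mathbb C}\mathcal T)_{\rm sa} : (\phi\otimes\psi)(x)\ge 0 \text{ for all positive linear functionals }\phi\text{ on }\mathcal R\text{ and }\psi\text{ on }\mathcal T\}$. *)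

theory Defs
  imports "HOL-Analysis.Analysis"
begin

text \<open>
  Both families of operator systems are spaces of complex-valued functions on an index type:
  an \<open>n \<times> n\<close> matrix is its entry function \<open>(i, j) \<mapsto> A(i, j)\<close> (zero unless \<open>i, j < n\<close>), an element
  of \<open>C(S\<^sup>1)\<close> is a function on the circle.  For complex vector spaces of functions, the algebraic
  tensor product is canonically the span of the functions \<open>(x, y) \<mapsto> a(x) b(y)\<close> on the product of
  the index types, and this is the model used here.  It specialises to the Kronecker product of
  matrices, to functions on \<open>S\<^sup>1 \<times> S\<^sup>1\<close>, and to matrix-valued functions on \<open>S\<^sup>1\<close>.

  Only the base cone of the matrix ordering is recorded, as the separable cone and its dual
  counterpart depend on nothing else.  The involution has the form \<open>f\<^sup>*(x) = cnj (f (flip x))\<close>,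
  where \<open>flip\<close> swaps row and column for matrices and is the identity for functions on the circle.
\<close>

record 'i op_system =
  elems :: "('i \<Rightarrow> complex) set"
  flip :: "'i \<Rightarrow> 'i"
  base_cone :: "('i \<Rightarrow> complex) set"

typedef circle = "sphere (0 :: complex) 1"
  morphisms complex_of_circle circle_of_complex
  by (rule exI[of _ 1]) simp

definition toeplitz_space :: "nat \<Rightarrow> (nat \<times> nat \<Rightarrow> complex) set" where
  "toeplitz_space n =
     {\<lambda>(i, j). if i < n \<and> j < n then t (int i - int j) else 0 | t :: int \<Rightarrow> complex. True}"

definition psd :: "nat \<Rightarrow> (nat \<times> nat \<Rightarrow> complex) \<Rightarrow> bool" where
  "psd n A \<longleftrightarrow>
     (\<forall>v :: nat \<Rightarrow> complex. (\<Sum>i<n. \<Sum>j<n. cnj (v i) * A (i, j) * v j) \<in> \<real>\<^sub>\<ge>\<^sub>0)"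

definition toeplitz :: "nat \<Rightarrow> (nat \<times> nat) op_system" where
  "toeplitz n =
     \<lparr>elems = toeplitz_space n, flip = prod.swap, base_cone = {A \<in> toeplitz_space n. psd n A}\<rparr>"

definition fejer_riesz_space :: "nat \<Rightarrow> (circle \<Rightarrow> complex) set" where
  "fejer_riesz_space n =
     {\<lambda>z. \<Sum>l = - int n + 1..int n - 1. \<alpha> l * complex_of_circle z powi l
       | \<alpha> :: int \<Rightarrow> complex. True}"

definition fejer_riesz :: "nat \<Rightarrow> circle op_system" where
  "fejer_riesz n =
     \<lparr>elems = fejer_riesz_space n, flip = id,
      base_cone = {f \<in> fejer_riesz_space n. \<forall>z. f z \<in> \<real>\<^sub>\<ge>\<^sub>0}\<rparr>"

definition tensor :: "('i \<Rightarrow> complex) \<Rightarrow> ('j \<Rightarrow> complex) \<Rightarrow> 'i \<times> 'j \<Rightarrow> complex"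
    (infixr "\<otimes>\<^sub>t" 70) where
  "a \<otimes>\<^sub>t b = (\<lambda>(x, y). a x * b y)"

definition tensor_sums ::
    "('i \<Rightarrow> complex) set \<Rightarrow> ('j \<Rightarrow> complex) set \<Rightarrow> ('i \<times> 'j \<Rightarrow> complex) set" where
  "tensor_sums A B =
     {\<lambda>p. \<Sum>j<k. (a j \<otimes>\<^sub>t b j) p | (k :: nat) a b. (\<forall>j<k. a j \<in> A) \<and> (\<forall>j<k. b j \<in> B)}"

definition tensor_sa :: "'i op_system \<Rightarrow> 'j op_system \<Rightarrow> ('i \<times> 'j \<Rightarrow> complex) set" where
  "tensor_sa R T =
     {u \<in> tensor_sums (elems R) (elems T). \<forall>x y. cnj (u (flip R x, flip T y)) = u (x, y)}"

definition linear_functional_on ::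
    "('i \<Rightarrow> complex) set \<Rightarrow> (('i \<Rightarrow> complex) \<Rightarrow> complex) \<Rightarrow> bool" where
  "linear_functional_on V \<phi> \<longleftrightarrow>
     (\<forall>f\<in>V. \<forall>g\<in>V. \<phi> (\<lambda>x. f x + g x) = \<phi> f + \<phi> g) \<and>
     (\<forall>c. \<forall>f\<in>V. \<phi> (\<lambda>x. c * f x) = c * \<phi> f)"

definition positive_functional ::
    "'i op_system \<Rightarrow> (('i \<Rightarrow> complex) \<Rightarrow> complex) \<Rightarrow> bool" where
  "positive_functional R \<phi> \<longleftrightarrow>
     linear_functional_on (elems R) \<phi> \<and> (\<forall>a\<in>base_cone R. \<phi> a \<in> \<real>\<^sub>\<ge>\<^sub>0)"

text \<open>
  The functional \<open>\<phi> \<otimes> \<psi>\<close>, evaluated by applying \<open>\<phi>\<close> in the first variable and then \<open>\<psi>\<close> in the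
  second; see \<open>tensor_functional_sum\<close> below.
\<close>

definition tensor_functional ::
    "(('i \<Rightarrow> complex) \<Rightarrow> complex) \<Rightarrow> (('j \<Rightarrow> complex) \<Rightarrow> complex) \<Rightarrow> ('i \<times> 'j \<Rightarrow> complex) \<Rightarrow> complex"
  where "tensor_functional \<phi> \<psi> u = \<psi> (\<lambda>y. \<phi> (\<lambda>x. u (x, y)))"

definition sep_cone :: "'i op_system \<Rightarrow> 'j op_system \<Rightarrow> ('i \<times> 'j \<Rightarrow> complex) set" where
  "sep_cone R T = tensor_sums (base_cone R) (base_cone T)"

definition sep_dual_cone :: "'i op_system \<Rightarrow> 'j op_system \<Rightarrow> ('i \<times> 'j \<Rightarrow> complex) set" where
  "sep_dual_cone R T =
     {u \<in> tensor_sa R T.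
        \<forall>\<phi> \<psi>. positive_functional R \<phi> \<longrightarrow> positive_functional T \<psi> \<longrightarrow>
          tensor_functional \<phi> \<psi> u \<in> \<real>\<^sub>\<ge>\<^sub>0}"

definition subspace_of_functions :: "('i \<Rightarrow> complex) set \<Rightarrow> bool" where
  "subspace_of_functions V \<longleftrightarrow>
     (\<lambda>x. 0) \<in> V \<and> (\<forall>f\<in>V. \<forall>g\<in>V. (\<lambda>x. f x + g x) \<in> V) \<and> (\<forall>c. \<forall>f\<in>V. (\<lambda>x. c * f x) \<in> V)"

lemma subspace_toeplitz: "subspace_of_functions (elems (toeplitz n))"
proof -
  let ?M = "\<lambda>t :: int \<Rightarrow> complex. \<lambda>(i, j). if i < n \<and> j < n then t (int i - int j) else 0"
  have zero: "(\<lambda>x. 0) = ?M (\<lambda>_. 0)" by auto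
  have add: "(\<lambda>x. ?M s x + ?M t x) = ?M (\<lambda>l. s l + t l)" for s t by auto
  have scale: "(\<lambda>x. c * ?M t x) = ?M (\<lambda>l. c * t l)" for c t by auto
  have mem: "?M t \<in> toeplitz_space n" for t unfolding toeplitz_space_def by blast
  have ex: "\<exists>t. f = ?M t" if "f \<in> toeplitz_space n" for f
    using that unfolding toeplitz_space_def by blast
  show ?thesis
    unfolding subspace_of_functions_def toeplitz_def op_system.simps
  proof (intro conjI ballI allI)
    show "(\<lambda>x. 0) \<in> toeplitz_space n" unfolding zero by (rule mem[of "\<lambda>_. 0"])
  next
    fix f g assume "f \<in> toeplitz_space n" "g \<in> toeplitz_space n"
    then obtain s t where st: "f = ?M s" "g = ?M t" using ex by meson
    show "(\<lambda>x. f x + g x) \<in> toeplitz_space n" unfolding st add by (rule mem[of "\<lambda>l. s l + t l"])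
  next
    fix c f assume "f \<in> toeplitz_space n"
    then obtain t where t: "f = ?M t" using ex by meson
    show "(\<lambda>x. c * f x) \<in> toeplitz_space n" unfolding t scale by (rule mem[of "\<lambda>l. c * t l"])
  qed
qed

lemma subspace_fejer_riesz: "subspace_of_functions (elems (fejer_riesz n))"
proof -
  let ?F = "\<lambda>(\<alpha> :: int \<Rightarrow> complex) z.
    \<Sum>l = - int n + 1..int n - 1. \<alpha> l * complex_of_circle z powi l"
  have zero: "(\<lambda>x. 0) = ?F (\<lambda>_. 0)" by auto
  have add: "(\<lambda>x. ?F s x + ?F t x) = ?F (\<lambda>l. s l + t l)" for s t
    by (simp add: sum.distrib distrib_right)
  have scale: "(\<lambda>x. c * ?F t x) = ?F (\<lambda>l. c * t l)" for c t
    by (simp add: sum_distrib_left mult.assoc)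
  have mem: "?F t \<in> fejer_riesz_space n" for t unfolding fejer_riesz_space_def by blast
  have ex: "\<exists>t. f = ?F t" if "f \<in> fejer_riesz_space n" for f
    using that unfolding fejer_riesz_space_def by blast
  show ?thesis
    unfolding subspace_of_functions_def fejer_riesz_def op_system.simps
  proof (intro conjI ballI allI)
    show "(\<lambda>x. 0) \<in> fejer_riesz_space n" unfolding zero by (rule mem[of "\<lambda>_. 0"])
  next
    fix f g assume "f \<in> fejer_riesz_space n" "g \<in> fejer_riesz_space n"
    then obtain s t where st: "f = ?F s" "g = ?F t" using ex by meson
    show "(\<lambda>x. f x + g x) \<in> fejer_riesz_space n" unfolding st add by (rule mem[of "\<lambda>l. s l + t l"])
  next
    fix c f assume "f \<in> fejer_riesz_space n"
    then obtain t where t: "f = ?F t" using ex by meson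
    show "(\<lambda>x. c * f x) \<in> fejer_riesz_space n" unfolding t scale by (rule mem[of "\<lambda>l. c * t l"])
  qed
qed

lemma linear_functional_sum:
  assumes V: "subspace_of_functions V" and \<phi>: "linear_functional_on V \<phi>"
    and a: "\<And>j. j < (k :: nat) \<Longrightarrow> a j \<in> V"
  shows "(\<lambda>x. \<Sum>j<k. a j x * c j) \<in> V \<and> \<phi> (\<lambda>x. \<Sum>j<k. a j x * c j) = (\<Sum>j<k. \<phi> (a j) * c j)"
  using a
proof (induction k)
  case 0
  have z: "(\<lambda>x. 0) \<in> V" using V by (simp add: subspace_of_functions_def)
  have "\<And>c f. f \<in> V \<Longrightarrow> \<phi> (\<lambda>x. c * f x) = c * \<phi> f"
    using \<phi> unfolding linear_functional_on_def by blast
  from this[OF z, of 0] show ?case using z by simp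
next
  case (Suc k)
  have V_add: "(\<lambda>x. f x + g x) \<in> V" if "f \<in> V" "g \<in> V" for f g
    using V that unfolding subspace_of_functions_def by blast
  have \<phi>_add: "\<phi> (\<lambda>x. f x + g x) = \<phi> f + \<phi> g" if "f \<in> V" "g \<in> V" for f g
    using \<phi> that unfolding linear_functional_on_def by blast
  let ?s = "\<lambda>x. \<Sum>j<k. a j x * c j" and ?t = "\<lambda>x. c k * a k x"
  have s: "?s \<in> V" "\<phi> ?s = (\<Sum>j<k. \<phi> (a j) * c j)" using Suc by auto
  have t: "?t \<in> V" using V Suc.prems[of k] unfolding subspace_of_functions_def by blast
  have pt: "\<phi> ?t = c k * \<phi> (a k)" using \<phi> Suc.prems[of k] unfolding linear_functional_on_def by blast
  have eq: "(\<lambda>x. \<Sum>j<Suc k. a j x * c j) = (\<lambda>x. ?s x + ?t x)" by (simp add: mult.commute)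
  have mem: "(\<lambda>x. ?s x + ?t x) \<in> V"
    by (rule V_add[OF s(1) t])
  have val: "\<phi> (\<lambda>x. ?s x + ?t x) = \<phi> ?s + \<phi> ?t"
    by (rule \<phi>_add[OF s(1) t])
  show ?case unfolding eq val s(2) pt using mem by (simp add: mult.commute)
qed

lemma tensor_functional_sum:
  assumes V: "subspace_of_functions V" "linear_functional_on V \<phi>" "\<And>j. j < (k :: nat) \<Longrightarrow> a j \<in> V"
    and W: "subspace_of_functions W" "linear_functional_on W \<psi>" "\<And>j. j < k \<Longrightarrow> b j \<in> W"
  shows "tensor_functional \<phi> \<psi> (\<lambda>p. \<Sum>j<k. (a j \<otimes>\<^sub>t b j) p) = (\<Sum>j<k. \<phi> (a j) * \<psi> (b j))"
proof -
  have 1: "\<phi> (\<lambda>x. \<Sum>j<k. a j x * b j y) = (\<Sum>j<k. \<phi> (a j) * b j y)" for y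
    using linear_functional_sum[OF V(1,2), of k a "\<lambda>j. b j y"] V(3) by blast
  have 2: "\<psi> (\<lambda>y. \<Sum>j<k. b j y * \<phi> (a j)) = (\<Sum>j<k. \<psi> (b j) * \<phi> (a j))"
    using linear_functional_sum[OF W(1,2), of k b "\<lambda>j. \<phi> (a j)"] W(3) by blast
  show ?thesis
    using 2 by (simp add: tensor_functional_def tensor_def 1 mult.commute)
qed

end

theory Submission
  imports Defs
begin

text \<open>
  Only the Fourier coefficients of the extreme degrees \<open>\<plusminus>(n - 1)\<close> and of degree \<open>0\<close> matter: on both
  systems a positive element satisfies \<open>|c\<^sub>1| \<le> \<rho> c\<^sub>0\<close>, and conversely \<open>u\<^sub>0 + w u\<^sub>1 + cnj w u\<^sub>1\<^sup>*\<close> is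
  positive whenever \<open>|w| = \<rho>\<close>, with \<open>\<rho> = 1\<close> for Toeplitz matrices and \<open>\<rho> = 1/2\<close> for trigonometric
  polynomials.  So both cones retract onto a three-dimensional Lorentz cone.  The element
  \<open>u\<^sub>0 \<otimes> v\<^sub>0 + 2 \<rho> \<sigma> (u\<^sub>1 \<otimes> v\<^sub>1 + u\<^sub>1\<^sup>* \<otimes> v\<^sub>1\<^sup>*)\<close> is nonnegative on products of positive functionals
  because these satisfy \<open>2 \<rho> |\<phi>(u\<^sub>1)| \<le> \<phi>(u\<^sub>0)\<close>, but it is not separable: its \<open>c\<^sub>1 \<otimes> d\<^sub>1\<close>-coefficient
  \<open>2 \<rho> \<sigma>\<close> exceeds \<open>\<rho> \<sigma>\<close> times its \<open>c\<^sub>0 \<otimes> d\<^sub>0\<close>-coefficient \<open>1\<close>.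
\<close>

section \<open>Abstract frames and the bound on positive functionals\<close>

text \<open>The values \<open>w = \<rho>\<close>, \<open>w = - \<rho>\<close> and
  \<open>w = \<i> \<rho>\<close> force \<open>p\<close> to be real and nonnegative and
  \<open>r\<close> to be conjugate to \<open>q\<close>. The expression is then
  \<open>p + 2 Re (w q)\<close>, and its minimum over the circle gives the bound.\<close>

lemma nonneg_on_circle:
  fixes p q r :: complex and \<rho> :: real
  assumes "\<rho> > 0"
    and pos: "\<And>w. cmod w = \<rho> \<Longrightarrow> p + w * q + cnj w * r \<in> \<real>\<^sub>\<ge>\<^sub>0"
  shows "p \<in> \<real>\<^sub>\<ge>\<^sub>0" and "r = cnj q" and "2 * \<rho> * cmod q \<le> cmod p"
proof -
  have *: "0 \<le> Re (p + w * q + cnj w * r) \<and> Im (p + w * q + cnj w * r) = 0"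
    if "cmod w = \<rho>" for w
    using pos[OF that] by (simp add: complex_nonneg_Reals_iff)
  have 1: "0 \<le> Re p + \<rho> * Re q + \<rho> * Re r" "Im p + \<rho> * Im q + \<rho> * Im r = 0"
    using *[of "complex_of_real \<rho>"] \<open>\<rho> > 0\<close> by auto
  have 2: "0 \<le> Re p - \<rho> * Re q - \<rho> * Re r" "Im p - \<rho> * Im q - \<rho> * Im r = 0"
    using *[of "- complex_of_real \<rho>"] \<open>\<rho> > 0\<close> by auto
  have 3: "Im p + \<rho> * Re q - \<rho> * Re r = 0"
    using *[of "\<i> * complex_of_real \<rho>"] \<open>\<rho> > 0\<close> by (auto simp: norm_mult)
  show p: "p \<in> \<real>\<^sub>\<ge>\<^sub>0" using 1 2 by (simp add: complex_nonneg_Reals_iff)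
  have "Im p = 0" using 1 2 by simp
  then have "\<rho> * (Im q + Im r) = 0" "\<rho> * (Re q - Re r) = 0"
    using 1 3 by (simp_all add: algebra_simps)
  with \<open>\<rho> > 0\<close> show r: "r = cnj q" by (auto simp: complex_eq_iff)
  show "2 * \<rho> * cmod q \<le> cmod p"
  proof (cases "q = 0")
    case False
    \<comment> \<open>The minimising phase, for which \<open>w * q\<close> is the negative real
      number \<open>- \<rho> |q|\<close>.\<close>
    define w where "w = - complex_of_real \<rho> * cnj q / cmod q"
    have "w * q = - complex_of_real (\<rho> * cmod q)"
      using False complex_norm_square[of q]
      by (simp add: w_def field_simps power2_eq_square)
    moreover from this have "cnj w * r = - complex_of_real (\<rho> * cmod q)"
      unfolding r by (metis complex_cnj_complex_of_real complex_cnj_minus complex_cnj_mult)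
    moreover have "cmod w = \<rho>" using False \<open>\<rho> > 0\<close> by (simp add: w_def norm_mult norm_divide)
    ultimately have "0 \<le> Re p - 2 * \<rho> * cmod q" using *[of w] by simp
    then show ?thesis using complex_Re_le_cmod[of p] by linarith
  qed simp
qed

text \<open>Abstracting from the two families lets one separation argument cover mixed pairs as
  well. The same radius occurs in \<open>frame_cone\<close> and in \<open>coord_bound\<close>; the
  factor 2 that separates the cones rests on this match.\<close>

locale lorentz_frame =
  fixes R :: "'i op_system" and \<rho> :: real
    and u0 u1 um :: "'i \<Rightarrow> complex" and c0 c1 :: "('i \<Rightarrow> complex) \<Rightarrow> complex"
  assumes subspace: "subspace_of_functions (elems R)"
    and cone_elems: "base_cone R \<subseteq> elems R"
    and radius_pos: "\<rho> > 0"
    and frame_elems: "u0 \<in> elems R" "u1 \<in> elems R" "um \<in> elems R"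
    and frame_adj: "cnj (u0 (flip R x)) = u0 x" "cnj (u1 (flip R x)) = um x"
      "cnj (um (flip R x)) = u1 x"
    and frame_cone: "cmod w = \<rho> \<Longrightarrow> (\<lambda>x. u0 x + w * u1 x + cnj w * um x) \<in> base_cone R"
    and coord_linear: "linear_functional_on (elems R) c0" "linear_functional_on (elems R) c1"
    and coord_frame: "c0 u0 = 1" "c0 u1 = 0" "c0 um = 0" "c1 u0 = 0" "c1 u1 = 1" "c1 um = 0"
    and coord_nonneg: "a \<in> base_cone R \<Longrightarrow> c0 a \<in> \<real>\<^sub>\<ge>\<^sub>0"
    and coord_bound: "a \<in> base_cone R \<Longrightarrow> cmod (c1 a) \<le> \<rho> * cmod (c0 a)"
begin

text \<open>A positive functional maps the circle of positive elements in \<open>frame_cone\<close>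
  to nonnegative numbers, so \<open>nonneg_on_circle\<close> applies to its values on the
  frame.\<close>

lemma positive_functional_frame:
  assumes "positive_functional R \<phi>"
  shows "\<phi> u0 \<in> \<real>\<^sub>\<ge>\<^sub>0" and "\<phi> um = cnj (\<phi> u1)" and "2 * \<rho> * cmod (\<phi> u1) \<le> cmod (\<phi> u0)"
proof -
  have lin: "linear_functional_on (elems R) \<phi>"
    and pos: "\<And>a. a \<in> base_cone R \<Longrightarrow> \<phi> a \<in> \<real>\<^sub>\<ge>\<^sub>0"
    using assms by (auto simp: positive_functional_def)
  have add: "\<phi> (\<lambda>x. f x + g x) = \<phi> f + \<phi> g" if "f \<in> elems R" "g \<in> elems R" for f g
    using lin that unfolding linear_functional_on_def by blast
  have scale: "\<phi> (\<lambda>x. c * f x) = c * \<phi> f" if "f \<in> elems R" for c f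
    using lin that unfolding linear_functional_on_def by blast
  have V_add: "(\<lambda>x. f x + g x) \<in> elems R" if "f \<in> elems R" "g \<in> elems R" for f g
    using subspace that unfolding subspace_of_functions_def by blast
  have V_scale: "(\<lambda>x. c * f x) \<in> elems R" if "f \<in> elems R" for c f
    using subspace that unfolding subspace_of_functions_def by blast
  have "\<phi> (\<lambda>x. u0 x + w * u1 x + cnj w * um x) = \<phi> u0 + w * \<phi> u1 + cnj w * \<phi> um" for w
  proof -
    have "\<phi> (\<lambda>x. u0 x + w * u1 x + cnj w * um x)
        = \<phi> (\<lambda>x. u0 x + w * u1 x) + \<phi> (\<lambda>x. cnj w * um x)"
      by (rule add) (auto intro!: V_add V_scale frame_elems)
    also have "\<phi> (\<lambda>x. u0 x + w * u1 x) = \<phi> u0 + \<phi> (\<lambda>x. w * u1 x)"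
      by (rule add) (auto intro!: V_add V_scale frame_elems)
    finally show ?thesis by (simp add: scale frame_elems)
  qed
  then have "\<phi> u0 + w * \<phi> u1 + cnj w * \<phi> um \<in> \<real>\<^sub>\<ge>\<^sub>0" if "cmod w = \<rho>" for w
    using pos[OF frame_cone[OF that]] by simp
  from nonneg_on_circle[OF radius_pos this]
  show "\<phi> u0 \<in> \<real>\<^sub>\<ge>\<^sub>0" "\<phi> um = cnj (\<phi> u1)" "2 * \<rho> * cmod (\<phi> u1) \<le> cmod (\<phi> u0)"
    by blast+
qed

end

section \<open>Separating the two cones for any pair of frames\<close>

theorem sep_cone_neq_sep_dual_cone:
  fixes R :: "'i op_system" and T :: "'j op_system"
  assumes "lorentz_frame R \<rho> u0 u1 um c0 c1" and "lorentz_frame T \<sigma> v0 v1 vm d0 d1"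
  shows "sep_cone R T \<noteq> sep_dual_cone R T"
proof
  interpret R: lorentz_frame R \<rho> u0 u1 um c0 c1 by fact
  interpret T: lorentz_frame T \<sigma> v0 v1 vm d0 d1 by fact
  define a where "a = (\<lambda>j :: nat. if j = 0 then u0 else if j = 1 then u1 else um)"
  \<comment> \<open>The weight is absorbed into the second factor, so that \<open>X\<close> is a
    plain sum of three elementary tensors, as \<open>tensor_sums\<close> demands.\<close>
  define b where "b = (\<lambda>j :: nat. if j = 0 then v0 else
     if j = 1 then (\<lambda>y. (2 * \<rho> * \<sigma>) * v1 y) else (\<lambda>y. (2 * \<rho> * \<sigma>) * vm y))"
  define X where "X = (\<lambda>p. \<Sum>j<3. (a j \<otimes>\<^sub>t b j) p)"
  have a: "a j \<in> elems R" for j using R.frame_elems by (auto simp: a_def)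
  have T_scale: "(\<lambda>y. c * f y) \<in> elems T" if "f \<in> elems T" for c f
    using T.subspace that unfolding subspace_of_functions_def by blast
  have b: "b j \<in> elems T" for j
    using T.frame_elems T_scale by (auto simp: b_def)
  have b_lin: "\<psi> (b 0) = \<psi> v0" "\<psi> (b 1) = (2 * \<rho> * \<sigma>) * \<psi> v1" "\<psi> (b 2) = (2 * \<rho> * \<sigma>) * \<psi> vm"
    if "linear_functional_on (elems T) \<psi>" for \<psi> :: "('j \<Rightarrow> complex) \<Rightarrow> complex"
    using that T.frame_elems unfolding linear_functional_on_def by (auto simp: b_def)
  \<comment> \<open>Positivity is not assumed here, since the formula serves both the positive
    functionals and the coordinate functionals.\<close>
  have tensor_X: "tensor_functional \<phi> \<psi> X
      = \<phi> u0 * \<psi> v0 + (2 * \<rho> * \<sigma>) * (\<phi> u1 * \<psi> v1 + \<phi> um * \<psi> vm)"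
    if "linear_functional_on (elems R) \<phi>" "linear_functional_on (elems T) \<psi>"
    for \<phi> :: "('i \<Rightarrow> complex) \<Rightarrow> complex" and \<psi> :: "('j \<Rightarrow> complex) \<Rightarrow> complex"
  proof -
    have "tensor_functional \<phi> \<psi> X = (\<Sum>j<3. \<phi> (a j) * \<psi> (b j))"
      unfolding X_def by (intro tensor_functional_sum[OF R.subspace that(1) _ T.subspace that(2)] a b)
    also have "\<dots> = \<phi> (a 0) * \<psi> (b 0) + \<phi> (a 1) * \<psi> (b 1) + \<phi> (a 2) * \<psi> (b 2)"
      by (simp add: numeral_3_eq_3 numeral_2_eq_2)
    finally show ?thesis
      unfolding b_lin[OF that(2)] by (simp add: a_def algebra_simps)
  qed
  have sa: "X \<in> tensor_sa R T"
    unfolding tensor_sa_def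
  proof (intro CollectI conjI allI)
    show "X \<in> tensor_sums (elems R) (elems T)"
      unfolding tensor_sums_def X_def using a b by blast
    show "cnj (X (flip R x, flip T y)) = X (x, y)" for x y
      by (simp add: X_def numeral_3_eq_3 a_def b_def tensor_def R.frame_adj T.frame_adj)
  qed
  have dual: "X \<in> sep_dual_cone R T"
    unfolding sep_dual_cone_def
  proof (intro CollectI conjI allI impI sa)
    fix \<phi> \<psi> assume \<phi>: "positive_functional R \<phi>" and \<psi>: "positive_functional T \<psi>"
    note f = R.positive_functional_frame[OF \<phi>] and g = T.positive_functional_frame[OF \<psi>]
    define z where "z = \<phi> u1 * \<psi> v1"
    \<comment> \<open>The two conjugate terms of \<open>X\<close> together contribute
      \<open>4 \<rho> \<sigma> Re z\<close>. The product of the two functional bounds absorbs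
      exactly this amount, which explains the weight \<open>2 \<rho> \<sigma>\<close>.\<close>
    have "(2 * \<rho> * cmod (\<phi> u1)) * (2 * \<sigma> * cmod (\<psi> v1)) \<le> cmod (\<phi> u0) * cmod (\<psi> v0)"
      using f(3) g(3) R.radius_pos T.radius_pos by (intro mult_mono) auto
    then have "4 * \<rho> * \<sigma> * cmod z \<le> cmod (\<phi> u0) * cmod (\<psi> v0)"
      by (simp add: z_def norm_mult algebra_simps)
    moreover have "cmod (\<phi> u0) * cmod (\<psi> v0) = Re (\<phi> u0 * \<psi> v0)" "\<phi> u0 * \<psi> v0 \<in> \<real>\<^sub>\<ge>\<^sub>0"
      using f(1) g(1)
      by (auto elim!: nonneg_Reals_cases simp flip: of_real_mult)
    moreover have "- (4 * \<rho> * \<sigma> * cmod z) \<le> 4 * \<rho> * \<sigma> * Re z"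
      using abs_Re_le_cmod[of z] R.radius_pos T.radius_pos
        mult_left_mono[of "- cmod z" "Re z" "4 * \<rho> * \<sigma>"] by simp
    moreover have "tensor_functional \<phi> \<psi> X = \<phi> u0 * \<psi> v0 + of_real (4 * \<rho> * \<sigma> * Re z)"
      using \<phi> \<psi> f(2) g(2) complex_add_cnj[of z]
      by (simp add: tensor_X positive_functional_def z_def flip: complex_cnj_mult)
    ultimately show "tensor_functional \<phi> \<psi> X \<in> \<real>\<^sub>\<ge>\<^sub>0"
      by (simp add: complex_nonneg_Reals_iff)
  qed
  assume "sep_cone R T = sep_dual_cone R T"
  with dual have "X \<in> tensor_sums (base_cone R) (base_cone T)"
    by (simp add: sep_cone_def)
  then obtain k :: nat and a' b' where X: "X = (\<lambda>p. \<Sum>j<k. (a' j \<otimes>\<^sub>t b' j) p)"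
    and a': "\<And>j. j < k \<Longrightarrow> a' j \<in> base_cone R" and b': "\<And>j. j < k \<Longrightarrow> b' j \<in> base_cone T"
    unfolding tensor_sums_def by blast
  have sum: "tensor_functional \<phi> \<psi> X = (\<Sum>j<k. \<phi> (a' j) * \<psi> (b' j))"
    if "linear_functional_on (elems R) \<phi>" "linear_functional_on (elems T) \<psi>" for \<phi> \<psi>
    unfolding X using a' b' R.cone_elems T.cone_elems
    by (intro tensor_functional_sum[OF R.subspace that(1) _ T.subspace that(2)]) auto
  have one: "(\<Sum>j<k. c0 (a' j) * d0 (b' j)) = 1"
    using sum[OF R.coord_linear(1) T.coord_linear(1)] tensor_X[OF R.coord_linear(1) T.coord_linear(1)]
    by (simp add: R.coord_frame T.coord_frame)
  have two: "(\<Sum>j<k. c1 (a' j) * d1 (b' j)) = of_real (2 * \<rho> * \<sigma>)"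
    using sum[OF R.coord_linear(2) T.coord_linear(2)] tensor_X[OF R.coord_linear(2) T.coord_linear(2)]
    by (simp add: R.coord_frame T.coord_frame)
  have "2 * \<rho> * \<sigma> = cmod (\<Sum>j<k. c1 (a' j) * d1 (b' j))"
    unfolding two norm_of_real using R.radius_pos T.radius_pos by simp
  also have "\<dots> \<le> (\<Sum>j<k. cmod (c1 (a' j)) * cmod (d1 (b' j)))"
    by (rule order_trans[OF norm_sum]) (simp add: norm_mult)
  also have "\<dots> \<le> (\<Sum>j<k. (\<rho> * cmod (c0 (a' j))) * (\<sigma> * cmod (d0 (b' j))))"
    using R.radius_pos T.radius_pos a' b'
    by (intro sum_mono mult_mono R.coord_bound T.coord_bound) auto
  also have "\<dots> = \<rho> * \<sigma> * (\<Sum>j<k. cmod (c0 (a' j)) * cmod (d0 (b' j)))"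
    by (simp add: sum_distrib_left algebra_simps)
  \<comment> \<open>All \<open>c0\<close> and \<open>d0\<close> values are nonnegative reals, so no
    cancellation occurs and the sum of moduli is the \<open>c0\<close>, \<open>d0\<close>
    coefficient of \<open>X\<close>. The chain then reads
    \<open>2 \<rho> \<sigma> \<le> \<rho> \<sigma>\<close>.\<close>
  also have "(\<Sum>j<k. cmod (c0 (a' j)) * cmod (d0 (b' j))) = (\<Sum>j<k. Re (c0 (a' j) * d0 (b' j)))"
  proof (rule sum.cong[OF refl])
    fix j assume "j \<in> {..<k}"
    then have "c0 (a' j) \<in> \<real>\<^sub>\<ge>\<^sub>0" "d0 (b' j) \<in> \<real>\<^sub>\<ge>\<^sub>0"
      using a' b' R.coord_nonneg T.coord_nonneg by auto
    then show "cmod (c0 (a' j)) * cmod (d0 (b' j)) = Re (c0 (a' j) * d0 (b' j))"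
      by (auto elim!: nonneg_Reals_cases simp flip: of_real_mult)
  qed
  also have "\<dots> = 1" using one by (metis Re_sum one_complex.simps(1))
  finally show False using R.radius_pos T.radius_pos by simp
qed

section \<open>The frame of a Toeplitz system\<close>

lemma linear_functional_eval: "linear_functional_on V (\<lambda>f. f x)"
  by (simp add: linear_functional_on_def)

lemma sum_two_support:
  fixes f :: "nat \<Rightarrow> 'a :: comm_monoid_add"
  assumes "0 < N" and "\<And>i. i \<noteq> 0 \<Longrightarrow> i \<noteq> N \<Longrightarrow> f i = 0"
  shows "(\<Sum>i<Suc N. f i) = f 0 + f N"
proof -
  have "(\<Sum>i<Suc N. f i) = (\<Sum>i\<in>{0, N}. f i)"
    using assms by (intro sum.mono_neutral_right) auto
  with \<open>0 < N\<close> show ?thesis by simp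
qed

text \<open>The extreme diagonals are single corner entries, so everything happens in the 2 by 2
  compression to the indices \<open>0\<close> and \<open>N\<close>. There \<open>1\<close> on the
  diagonal and \<open>w\<close>, \<open>cnj w\<close> off it give a positive semidefinite matrix
  when \<open>|w| = 1\<close>.\<close>

lemma lorentz_frame_toeplitz:
  assumes "n \<ge> 2"
  shows "\<exists>u0 u1 um c0 c1. lorentz_frame (toeplitz n) 1 u0 u1 um c0 c1"
proof -
  define N where "N = n - 1"
  have n: "n = Suc N" and N: "0 < N" using assms by (auto simp: N_def)
  define M where "M = (\<lambda>t :: int \<Rightarrow> complex. \<lambda>(i, j). if i < n \<and> j < n then t (int i - int j) else 0)"
  define u where "u = (\<lambda>k :: int. M (\<lambda>l. if l = k then 1 else 0))"
  have M_mem: "M t \<in> toeplitz_space n" for t unfolding toeplitz_space_def M_def by blast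
  have cone: "psd n (\<lambda>x. u 0 x + w * u (int N) x + cnj w * u (- int N) x)" if w: "cmod w = 1" for w
    unfolding psd_def
  proof
    fix v :: "nat \<Rightarrow> complex"
    have ww: "cnj w * w = 1" using complex_norm_square[of w] w by (simp add: mult.commute)
    let ?A = "\<lambda>x. u 0 x + w * u (int N) x + cnj w * u (- int N) x"
    have entry: "?A (i, j) = (if i = j then 1 else 0) + (if i = N \<and> j = 0 then w else 0)
        + (if i = 0 \<and> j = N then cnj w else 0)" if "i < n" "j < n" for i j
      using that N by (auto simp: u_def M_def n)
    have "(\<Sum>i<n. \<Sum>j<n. cnj (v i) * ?A (i, j) * v j)
      = (\<Sum>i<n. \<Sum>j<n. (if i = j then cnj (v i) * v j else 0)
          + (if i = N \<and> j = 0 then cnj (v i) * w * v j else 0)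
          + (if i = 0 \<and> j = N then cnj (v i) * cnj w * v j else 0))"
      by (intro sum.cong refl, subst entry) (auto simp: algebra_simps)
    also have "\<dots> = (\<Sum>i<n. cnj (v i) * v i) + cnj (v N) * w * v 0 + cnj (v 0) * cnj w * v N"
    proof -
      have "(\<Sum>i<n. \<Sum>j<n. if i = p \<and> j = q then h i j else 0) = h p q"
        if "p < n" "q < n" for p q and h :: "nat \<Rightarrow> nat \<Rightarrow> complex"
      proof -
        have "(\<Sum>i<n. \<Sum>j<n. if i = p \<and> j = q then h i j else 0)
            = (\<Sum>i<n. if i = p then (\<Sum>j<n. if j = q then h i j else 0) else 0)"
          by (intro sum.cong) auto
        with that show ?thesis by simp
      qed
      then show ?thesis by (simp add: sum.distrib n)
    qed
    \<comment> \<open>Completing the square: as \<open>|w| = 1\<close>, the diagonal terms at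
      \<open>0\<close> and \<open>N\<close> and both corner terms form one squared modulus.\<close>
    also have "\<dots> = of_real ((\<Sum>i\<in>{..<n} - {0, N}. (cmod (v i))\<^sup>2) + (cmod (v 0 + cnj w * v N))\<^sup>2)"
    proof -
      have "(\<Sum>i<n. cnj (v i) * v i) = (\<Sum>i\<in>{..<n} - {0, N}. cnj (v i) * v i) + (\<Sum>i\<in>{0, N}. cnj (v i) * v i)"
        by (rule sum.subset_diff) (auto simp: n)
      then have "(\<Sum>i<n. cnj (v i) * v i)
          = (\<Sum>i\<in>{..<n} - {0, N}. of_real ((cmod (v i))\<^sup>2)) + cnj (v 0) * v 0 + cnj (v N) * v N"
        using N by (simp add: complex_norm_square mult.commute del: of_real_power)
      moreover have "of_real ((cmod (v 0 + cnj w * v N))\<^sup>2)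
          = cnj (v 0) * v 0 + (cnj w * w) * (cnj (v N) * v N) + cnj (v N) * w * v 0 + cnj (v 0) * cnj w * v N"
        by (simp only: complex_norm_square) (simp add: algebra_simps)
      ultimately show ?thesis by (simp add: ww)
    qed
    finally show "(\<Sum>i<n. \<Sum>j<n. cnj (v i) * ?A (i, j) * v j) \<in> \<real>\<^sub>\<ge>\<^sub>0"
      by (simp only: nonneg_Reals_of_real_iff) (simp add: sum_nonneg)
  qed
  have corner: "A (0, 0) \<in> \<real>\<^sub>\<ge>\<^sub>0 \<and> cmod (A (N, 0)) \<le> cmod (A (0, 0))"
    if "A \<in> toeplitz_space n" "psd n A" for A
  proof -
    \<comment> \<open>The two corners of the diagonal agree because the matrix is Toeplitz.\<close>
    have diag: "A (N, N) = A (0, 0)" using that(1) by (auto simp: toeplitz_space_def n)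
    have "2 * A (0, 0) + w * A (N, 0) + cnj w * A (0, N) \<in> \<real>\<^sub>\<ge>\<^sub>0" if w: "cmod w = 1" for w
    proof -
      have ww: "w * cnj w = 1" using complex_norm_square[of w] w by simp
      \<comment> \<open>A test vector supported on \<open>0\<close> and \<open>N\<close>. Its
        quadratic form has constant term \<open>2 * A (0, 0)\<close>, which cancels the 2 in
        \<open>nonneg_on_circle\<close> and leaves radius 1.\<close>
      define v where "v = (\<lambda>i :: nat. if i = 0 then 1 else if i = N then cnj w else 0)"
      have "(\<Sum>i<n. \<Sum>j<n. cnj (v i) * A (i, j) * v j) \<in> \<real>\<^sub>\<ge>\<^sub>0"
        using \<open>psd n A\<close> by (simp add: psd_def)
      also have "(\<Sum>i<n. \<Sum>j<n. cnj (v i) * A (i, j) * v j)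
          = A (0, 0) + A (0, N) * cnj w + (w * A (N, 0) + w * A (N, N) * cnj w)"
        unfolding n using N by (simp add: sum_two_support v_def del: sum.lessThan_Suc)
      also have "w * A (N, N) * cnj w = A (0, 0)"
        using ww by (simp add: diag mult.commute mult.left_commute)
      finally show ?thesis by (simp add: algebra_simps)
    qed
    from nonneg_on_circle[OF zero_less_one this] show ?thesis
      by (auto simp: complex_nonneg_Reals_iff norm_mult)
  qed
  have "lorentz_frame (toeplitz n) 1 (u 0) (u (int N)) (u (- int N)) (\<lambda>A. A (0, 0)) (\<lambda>A. A (N, 0))"
  proof
    show "subspace_of_functions (elems (toeplitz n))" by (rule subspace_toeplitz)
    show "(\<lambda>x. u 0 x + w * u (int N) x + cnj w * u (- int N) x) \<in> base_cone (toeplitz n)"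
      if "cmod w = 1" for w
    proof -
      have "(\<lambda>x. u 0 x + w * u (int N) x + cnj w * u (- int N) x)
          = M (\<lambda>l. (if l = 0 then 1 else 0) + w * (if l = int N then 1 else 0)
              + cnj w * (if l = - int N then 1 else 0))"
        by (auto simp: u_def M_def)
      with M_mem cone[OF that] show ?thesis by (simp add: toeplitz_def)
    qed
  qed (use N corner in \<open>auto simp: toeplitz_def linear_functional_eval u_def M_mem\<close>,
      auto simp: M_def n)
  then show ?thesis by blast
qed

section \<open>The frame of a trigonometric polynomial system\<close>

text \<open>Averages over \<open>N\<close> equally spaced points reduce a polynomial to its degrees
  \<open>0\<close> and \<open>\<plusminus>N\<close>. The coordinates are built from values of the
  function, so they are linear functionals without appeal to uniqueness of its coefficients.\<close>

lemma lorentz_frame_fejer_riesz: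
  assumes "n \<ge> 2"
  shows "\<exists>u0 u1 um c0 c1. lorentz_frame (fejer_riesz n) (1/2) u0 u1 um c0 c1"
proof -
  define N where "N = n - 1"
  have n: "int n - 1 = int N" "- int n + 1 = - int N" and N: "0 < N" using assms by (auto simp: N_def)
  define F where "F = (\<lambda>\<alpha> :: int \<Rightarrow> complex. \<lambda>z.
    \<Sum>l = - int N..int N. \<alpha> l * complex_of_circle z powi l)"
  have space: "fejer_riesz_space n = range F"
    unfolding fejer_riesz_space_def F_def n by blast
  define pt where "pt = (\<lambda>\<theta> (j :: nat). circle_of_complex (cis ((\<theta> + 2 * pi * j) / N)))"
  have pt: "complex_of_circle (pt \<theta> j) = cis ((\<theta> + 2 * pi * j) / N)" for \<theta> j
    by (simp add: pt_def circle_of_complex_inverse)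
  \<comment> \<open>Averaging over the points with \<open>z\<^sup>N = e\<^sup>i\<^sup>\<theta>\<close> is positive and annihilates all degrees but \<open>0, \<plusminus>N\<close>.\<close>
  define g where "g = (\<lambda>\<theta> (f :: circle \<Rightarrow> complex). (\<Sum>j<N. f (pt \<theta> j)) / N)"
  have g_powi: "g \<theta> (\<lambda>z. complex_of_circle z powi l) = (if int N dvd l then cis (\<theta> * l / N) else 0)" for \<theta> l
  proof -
    \<comment> \<open>The ratio of the geometric progression formed by the values at the sample
      points. It is an \<open>N\<close>-th root of unity, so the sum vanishes unless the ratio is
      1.\<close>
    define \<zeta> where "\<zeta> = cis (2 * pi * l / N)"
    have "complex_of_circle (pt \<theta> j) powi l = cis (\<theta> * l / N) * \<zeta> ^ j" for j
      unfolding pt \<zeta>_def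
      using N by (simp add: cis_power_int Complex.DeMoivre cis_mult field_simps)
    then have g: "g \<theta> (\<lambda>z. complex_of_circle z powi l) = cis (\<theta> * l / N) * (\<Sum>j<N. \<zeta> ^ j) / N"
      by (simp add: g_def sum_distrib_left)
    have \<zeta>1: "\<zeta> = 1 \<longleftrightarrow> int N dvd l"
    proof -
      have "\<zeta> = 1 \<longleftrightarrow> (\<exists>k :: int. 2 * pi * l / N = 2 * pi * k)"
        by (auto simp: \<zeta>_def cis_conv_exp exp_eq_1 mult.commute mult.left_commute)
      also have "\<dots> \<longleftrightarrow> (\<exists>k :: int. real_of_int l = real_of_int (int N * k))"
        using N by (intro ex_cong1) (auto simp: field_simps)
      finally show ?thesis by (simp only: of_int_eq_iff dvd_def)
    qed
    have \<zeta>N: "\<zeta> ^ N = 1" using N by (simp add: \<zeta>_def Complex.DeMoivre cis_multiple_2pi)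
    show ?thesis
    proof (cases "\<zeta> = 1")
      case True
      then show ?thesis using g \<zeta>1 N by simp
    next
      case False
      then have "(\<Sum>j<N. \<zeta> ^ j) = 0" by (simp add: sum_gp_strict \<zeta>N)
      then show ?thesis using g \<zeta>1 False by simp
    qed
  qed
  have g_F: "g \<theta> (F \<alpha>) = \<alpha> 0 + cis \<theta> * \<alpha> (int N) + cnj (cis \<theta>) * \<alpha> (- int N)" for \<theta> \<alpha>
  proof -
    have "g \<theta> (F \<alpha>) = (\<Sum>l = - int N..int N. \<alpha> l * g \<theta> (\<lambda>z. complex_of_circle z powi l))"
      unfolding g_def F_def
      by (subst sum.swap) (simp add: sum_distrib_left sum_divide_distrib)
    \<comment> \<open>The only multiples of \<open>N\<close> in the range of degrees are
      \<open>-N\<close>, \<open>0\<close> and \<open>N\<close>.\<close>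
    also have "\<dots> = (\<Sum>l\<in>{- int N, 0, int N}. \<alpha> l * g \<theta> (\<lambda>z. complex_of_circle z powi l))"
    proof (rule sum.mono_neutral_right)
      show "\<forall>l\<in>{- int N..int N} - {- int N, 0, int N}. \<alpha> l * g \<theta> (\<lambda>z. complex_of_circle z powi l) = 0"
      proof
        fix l assume l: "l \<in> {- int N..int N} - {- int N, 0, int N}"
        then have "0 < \<bar>l\<bar>" "\<bar>l\<bar> < int N" by auto
        then have "\<not> int N dvd l" using zdvd_not_zless[of "\<bar>l\<bar>" "int N"] by simp
        then show "\<alpha> l * g \<theta> (\<lambda>z. complex_of_circle z powi l) = 0" by (simp add: g_powi)
      qed
    qed auto
    also have "\<dots> = \<alpha> 0 + cis \<theta> * \<alpha> (int N) + cnj (cis \<theta>) * \<alpha> (- int N)"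
      using N by (simp add: g_powi cis_cnj)
    finally show ?thesis .
  qed
  have g_lin: "g \<theta> (\<lambda>x. f x + h x) = g \<theta> f + g \<theta> h" "g \<theta> (\<lambda>x. c * f x) = c * g \<theta> f" for \<theta> f h c
    by (simp_all add: g_def sum.distrib add_divide_distrib sum_distrib_left)
  \<comment> \<open>Coefficients of degrees \<open>0\<close> and \<open>N\<close>, read off from \<open>g \<theta> f\<close> at \<open>e\<^sup>i\<^sup>\<theta> = \<plusminus>1, \<plusminus>\<i>\<close>.\<close>
  define c0 where "c0 = (\<lambda>f. (g 0 f + g pi f) / 2)"
  define c1 where "c1 = (\<lambda>f. (g 0 f - g pi f - \<i> * (g (pi / 2) f - g (- (pi / 2)) f)) / 4)"
  have c_F: "c0 (F \<alpha>) = \<alpha> 0" "c1 (F \<alpha>) = \<alpha> (int N)" for \<alpha>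
    by (simp_all add: c0_def c1_def g_F cis_cnj algebra_simps flip: cis_inverse)
  have bound: "c0 f \<in> \<real>\<^sub>\<ge>\<^sub>0 \<and> 2 * cmod (c1 f) \<le> cmod (c0 f)"
    if f: "f \<in> fejer_riesz_space n" "\<And>z. f z \<in> \<real>\<^sub>\<ge>\<^sub>0" for f
  proof -
    obtain \<alpha> where \<alpha>: "f = F \<alpha>" using f(1) space by auto
    \<comment> \<open>Averaging at the angle of \<open>w\<close> yields this expression. The
      constant term is now \<open>\<alpha> 0\<close> itself, so the 2 in
      \<open>nonneg_on_circle\<close> survives and the radius is 1/2.\<close>
    have "\<alpha> 0 + w * \<alpha> (int N) + cnj w * \<alpha> (- int N) \<in> \<real>\<^sub>\<ge>\<^sub>0" if w: "cmod w = 1" for w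
    proof -
      obtain \<theta> where "w = cis \<theta>" using w by (metis complex_norm_eq_1_exp cis_conv_exp)
      moreover have "g \<theta> f \<in> \<real>\<^sub>\<ge>\<^sub>0"
        using f(2) by (simp add: g_def complex_nonneg_Reals_iff sum_nonneg)
      ultimately show ?thesis by (simp add: \<alpha> g_F)
    qed
    from nonneg_on_circle[OF zero_less_one this] show ?thesis by (simp add: \<alpha> c_F)
  qed
  define \<delta> where "\<delta> = (\<lambda>k l :: int. if l = k then 1 else 0 :: complex)"
  define u where "u = (\<lambda>k. F (\<delta> k))"
  have u: "u k z = complex_of_circle z powi k" if "\<bar>k\<bar> \<le> int N" for k z
  proof -
    have "u k z = (\<Sum>l = - int N..int N. if l = k then complex_of_circle z powi l else 0)"
      unfolding u_def F_def \<delta>_def by (intro sum.cong) auto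
    with that show ?thesis by (simp add: abs_le_iff)
  qed
  have cmod_circle: "cmod (complex_of_circle z) = 1" for z
    using complex_of_circle[of z] by simp
  have cnj_powi: "cnj (complex_of_circle z powi k) = complex_of_circle z powi (- k)" for z k
  proof -
    obtain \<theta> where "complex_of_circle z = cis \<theta>"
      by (metis cmod_circle complex_norm_eq_1_exp cis_conv_exp)
    then show ?thesis by (simp add: cis_power_int cis_cnj)
  qed
  have u_adj: "cnj (u k z) = u (- k) z" if "\<bar>k\<bar> \<le> int N" for k z
    using that by (simp add: u cnj_powi del: complex_cnj_power_int)
  have "lorentz_frame (fejer_riesz n) (1/2) (u 0) (u (int N)) (u (- int N)) c0 c1"
  proof
    show "subspace_of_functions (elems (fejer_riesz n))" by (rule subspace_fejer_riesz)
    show "(\<lambda>x. u 0 x + w * u (int N) x + cnj w * u (- int N) x) \<in> base_cone (fejer_riesz n)"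
      if w: "cmod w = 1/2" for w
    proof -
      have "(\<lambda>x. u 0 x + w * u (int N) x + cnj w * u (- int N) x)
          = F (\<lambda>l. \<delta> 0 l + w * \<delta> (int N) l + cnj w * \<delta> (- int N) l)"
        by (auto simp: u_def F_def sum.distrib sum_distrib_left algebra_simps)
      then have "(\<lambda>x. u 0 x + w * u (int N) x + cnj w * u (- int N) x) \<in> range F" by blast
      moreover have "u 0 z + w * u (int N) z + cnj w * u (- int N) z \<in> \<real>\<^sub>\<ge>\<^sub>0" for z
      proof -
        \<comment> \<open>The value is \<open>1 + 2 Re q\<close> with \<open>|q| = 1/2\<close>,
          hence nonnegative.\<close>
        define q where "q = w * complex_of_circle z powi int N"
        have "cmod q = 1/2" by (simp add: q_def norm_mult norm_power cmod_circle w)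
        then have "\<bar>Re q\<bar> \<le> 1/2" using abs_Re_le_cmod[of q] by simp
        moreover have "u 0 z + w * u (int N) z + cnj w * u (- int N) z = 1 + (q + cnj q)"
          unfolding q_def complex_cnj_mult cnj_powi by (simp add: u)
        ultimately show ?thesis by (simp add: complex_nonneg_Reals_iff)
      qed
      ultimately show ?thesis by (simp add: fejer_riesz_def space)
    qed
    show "linear_functional_on (elems (fejer_riesz n)) c0"
         "linear_functional_on (elems (fejer_riesz n)) c1"
      by (auto simp: linear_functional_on_def c0_def c1_def g_lin algebra_simps
          add_divide_distrib diff_divide_distrib)
    show "cmod (c1 a) \<le> 1/2 * cmod (c0 a)" if "a \<in> base_cone (fejer_riesz n)" for a
      using bound[of a] that by (simp add: fejer_riesz_def)
  qed (use N bound in \<open>auto simp: fejer_riesz_def space u_adj\<close>,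
      auto simp: u_def c_F \<delta>_def)
  then show ?thesis by blast
qed

theorem theorem1p9:
  fixes n m :: nat
  assumes "n \<ge> 2" and "m \<ge> 2"
  shows "sep_cone (toeplitz n) (toeplitz m) \<noteq> sep_dual_cone (toeplitz n) (toeplitz m) \<and>
         sep_cone (toeplitz n) (fejer_riesz m) \<noteq> sep_dual_cone (toeplitz n) (fejer_riesz m) \<and>
         sep_cone (fejer_riesz n) (toeplitz m) \<noteq> sep_dual_cone (fejer_riesz n) (toeplitz m) \<and>
         sep_cone (fejer_riesz n) (fejer_riesz m) \<noteq> sep_dual_cone (fejer_riesz n) (fejer_riesz m)"
proof -
  note frames = lorentz_frame_toeplitz[OF assms(1)] lorentz_frame_toeplitz[OF assms(2)]
    lorentz_frame_fejer_riesz[OF assms(1)] lorentz_frame_fejer_riesz[OF assms(2)]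
  show ?thesis
    by (intro conjI) (use frames sep_cone_neq_sep_dual_cone in metis)+
qed

end
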